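(* Let $r\ge 2$ be an integer. Then $\gamma_r(2)$ is the smallest cardinality of a subset $C\subseteq\mathbb{F}_2^r$ with the property that every element of $\mathbb{F}_2^r$ is representable as a sum of three pairwise distinct elements from $C$. Consequently, $\gamma_r(2)=\Theta(2^{r/3})$; that is, there exist absolute constants $0<c_1\le c_2$ such that $c_1 2^{r/3}\le\gamma_r(2)\le c_2 2^{r/3}$ for all integers $r\ge 2$.
   Context: Let $\mathbb{F}_2^r$ be the $r$-dimensional vector space over the two-element field, and let $0\le d\le r$ be an integer. A subset $C\subseteq\mathbb{F}_2^r$ is called $d$-complete if for every $v\in\mathbb{F}_2^r$ there exists a linear subspace $L_v\le\mathbb{F}_2^r$ of dimension $d$ such that $v+(L_v\setminus\{0\})\subseteq C$. By $\gamma_r(d)$ we denote the smallest possible size of a $d$-complete subset of $\mathbb{F}_2^r$. *)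

theory Defs
  imports Complex_Main "HOL-Library.Z2" "Jordan_Normal_Form.VS_Connect"
begin

text \<open>
  The space of \<open>r\<close>-dimensional vectors over the two-element field is
  \<open>carrier_vec r :: bit vec set\<close>; the dimension is a term, so that it can be quantified over.
\<close>

abbreviation F2_space :: "nat \<Rightarrow> (bit, bit vec) module" where
  "F2_space r \<equiv> module_vec TYPE(bit) r"

text \<open>
  In \<open>F2_subspace_of_dim\<close>, replacing the carrier of the module record by \<open>L\<close> turns the
  subspace into a vector space of its own, whose dimension is the intended one.
\<close>

definition F2_subspace_of_dim :: "nat \<Rightarrow> nat \<Rightarrow> bit vec set \<Rightarrow> bool" where
  "F2_subspace_of_dim r d L \<longleftrightarrow>
     VectorSpace.subspace class_ring L (F2_space r) \<and>
     vectorspace.dim class_ring (F2_space r\<lparr>carrier := L\<rparr>) = d"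

definition d_complete :: "nat \<Rightarrow> nat \<Rightarrow> bit vec set \<Rightarrow> bool" where
  "d_complete r d C \<longleftrightarrow>
     C \<subseteq> carrier_vec r \<and>
     (\<forall>v \<in> carrier_vec r. \<exists>L. F2_subspace_of_dim r d L \<and> (\<lambda>u. v + u) ` (L - {0\<^sub>v r}) \<subseteq> C)"

lemma F2_subspace_of_dim_exists:
  assumes "d \<le> r"
  shows "\<exists>L. F2_subspace_of_dim r d L"
proof -
  interpret V: vec_space "TYPE(bit)" r .
  define B :: "bit vec set" where "B = set (take d (unit_vecs r))"
  have BU: "B \<subseteq> set (unit_vecs r)"
    unfolding B_def by (rule set_take_subset)
  have Bc: "B \<subseteq> carrier_vec r"
    using BU unit_vecs_carrier[of r] by auto
  have li: "\<not> V.lin_dep B"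
    using V.unit_vecs_basis BU V.subset_li_is_li unfolding V.basis_def by blast
  have sub: "VectorSpace.subspace class_ring (V.span B) (F2_space r)"
    by (rule V.span_is_subspace[OF Bc])
  interpret W: vectorspace class_ring "F2_space r\<lparr>carrier := V.span B\<rparr>"
    by (rule V.subspace_is_vs[OF sub])
  have sm: "submodule class_ring (V.span B) (F2_space r)"
    using sub by (simp add: VectorSpace.subspace_def)
  have inB: "B \<subseteq> V.span B"
    by (rule V.in_own_span[OF Bc])
  have "W.basis B"
    unfolding W.basis_def
    using li inB
    by (simp only: V.span_li_not_depend[OF inB sm] V.carrier_vs_is_self simp_thms)
  then have "W.dim = card B"
    by (intro W.dim_basis) (simp_all add: B_def)
  also have "card B = d"
    unfolding B_def using assms
    by (simp add: distinct_card[OF distinct_take[OF V.unit_vecs_distinct]])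
  finally show ?thesis
    using sub unfolding F2_subspace_of_dim_def by blast
qed

lemma d_complete_carrier_vec:
  assumes "d \<le> r"
  shows "d_complete r d (carrier_vec r)"
proof -
  obtain L where L: "F2_subspace_of_dim r d L"
    using F2_subspace_of_dim_exists[OF assms] by blast
  have "L \<subseteq> carrier_vec r"
  proof -
    have "submodule class_ring L (F2_space r)"
      using L unfolding F2_subspace_of_dim_def VectorSpace.subspace_def by blast
    then have "L \<subseteq> carrier (F2_space r)"
      by (rule submodule.subset)
    then show ?thesis
      by (simp only: module_vec_simps)
  qed
  then have "(\<lambda>u. v + u) ` (L - {0\<^sub>v r}) \<subseteq> carrier_vec r" if "v \<in> carrier_vec r" for v
    using that by (auto intro!: add_carrier_vec)
  with L show ?thesis
    unfolding d_complete_def by (intro conjI ballI exI[of _ L]) simp_all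
qed

text \<open>
  The minimum below is attained for \<open>d \<le> r\<close>, by \<open>d_complete_carrier_vec\<close>.
  Subsets of \<open>carrier_vec r\<close> are finite, so \<open>card\<close> is the true cardinality.
\<close>

definition gamma :: "nat \<Rightarrow> nat \<Rightarrow> nat" where
  "gamma r d = (LEAST n. \<exists>C. d_complete r d C \<and> card C = n)"

definition three_sum_representing :: "nat \<Rightarrow> bit vec set \<Rightarrow> bool" where
  "three_sum_representing r C \<longleftrightarrow>
     C \<subseteq> carrier_vec r \<and>
     (\<forall>v \<in> carrier_vec r. \<exists>x \<in> C. \<exists>y \<in> C. \<exists>z \<in> C.
        x \<noteq> y \<and> x \<noteq> z \<and> y \<noteq> z \<and> v = x + y + z)"

end

theory Submission
  imports Defs
begin

text \<open>
  A plane over the two-element field is \<open>{0, a, b, a + b}\<close> with \<open>0, a, b\<close> distinct, and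
  \<open>(v + a) + (v + b) + (v + a + b) = v\<close>. Hence \<open>v + (L - {0}) \<subseteq> C\<close> for some plane \<open>L\<close>
  if and only if \<open>v\<close> is a sum of three distinct elements of \<open>C\<close>.

  Such sums cover at most \<open>card C ^ 3\<close> vectors, which gives the lower bound. For the upper
  bound, cut the coordinates into three blocks of about \<open>r / 3\<close> elements: every vector is a sum of
  three vectors supported on one block each. If two summands coincide they cancel, and the
  vector itself is supported on a block; adding a fixed plane to the three block
  subspaces takes care of these.
\<close>

section \<open>Arithmetic and counting of binary vectors\<close>

lemma bit_vec_add_left_cancel:
  fixes v x y :: "bit vec"
  assumes "v \<in> carrier_vec r" "x \<in> carrier_vec r" "y \<in> carrier_vec r"
  shows "v + x = v + y \<longleftrightarrow> x = y"
proof
  assume "v + x = v + y"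
  moreover have "v + (v + x) = x" "v + (v + y) = y"
    using assms by (auto intro!: eq_vecI)
  ultimately show "x = y" by metis
qed simp

lemma bit_vec_add_eq_0_iff:
  fixes x y :: "bit vec"
  assumes "x \<in> carrier_vec r" "y \<in> carrier_vec r"
  shows "x + y = 0\<^sub>v r \<longleftrightarrow> x = y"
proof -
  have "x + x = 0\<^sub>v r" using assms by (auto intro!: eq_vecI)
  then show ?thesis using bit_vec_add_left_cancel[of x r y x] assms by auto
qed

text \<open>Identifies a vector with its support: counting vectors becomes counting subsets, and a
  block of coordinates gives the image of a power set.\<close>

definition indicator_vec :: "nat \<Rightarrow> nat set \<Rightarrow> bit vec" where
  "indicator_vec r S = vec r (\<lambda>i. if i \<in> S then 1 else 0)"

lemma indicator_vec_carrier [simp]: "indicator_vec r S \<in> carrier_vec r"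
  by (simp add: indicator_vec_def)

lemma carrier_vec_indicator: "carrier_vec r = indicator_vec r ` Pow {..<r}"
proof (intro equalityI subsetI)
  fix v :: "bit vec" assume "v \<in> carrier_vec r"
  then have "v = indicator_vec r {i. i < r \<and> v $ i = 1}"
    by (auto intro!: eq_vecI simp: indicator_vec_def)
  then show "v \<in> indicator_vec r ` Pow {..<r}" by blast
qed auto

lemma inj_on_indicator_vec: "inj_on (indicator_vec r) (Pow {..<r})"
proof (rule inj_onI)
  fix S T assume ST: "S \<in> Pow {..<r}" "T \<in> Pow {..<r}" "indicator_vec r S = indicator_vec r T"
  have "S = {i. i < r \<and> indicator_vec r S $ i = 1}" "T = {i. i < r \<and> indicator_vec r T $ i = 1}"
    using ST(1,2) by (auto simp: indicator_vec_def split: if_splits)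
  with ST(3) show "S = T" by simp
qed

lemma card_carrier_vec_bit: "card (carrier_vec r :: bit vec set) = 2 ^ r"
  by (simp add: carrier_vec_indicator card_image[OF inj_on_indicator_vec] card_Pow)

lemma finite_carrier_vec_bit: "finite (carrier_vec r :: bit vec set)"
  by (simp add: carrier_vec_indicator)

section \<open>Planes as two-dimensional subspaces\<close>

lemma submodule_plane:
  fixes a b :: "bit vec"
  assumes "a \<in> carrier_vec r" "b \<in> carrier_vec r"
  shows "submodule class_ring {0\<^sub>v r, a, b, a + b} (F2_space r)"
proof -
  have [simp]: "dim_vec a = r" "dim_vec b = r" using assms by auto
  \<comment> \<open>The addition table behind closure; each entry comes from
    \<open>1 + 1 = 0\<close>.\<close>
  have "a + a = 0\<^sub>v r" "b + b = 0\<^sub>v r" "b + a = a + b" "a + (a + b) = b" "a + b + a = b"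
    "b + (a + b) = a" "a + b + b = a" "a + b + (a + b) = 0\<^sub>v r"
    by (auto intro!: eq_vecI simp: ac_simps)
  note s = this
  show ?thesis
  proof (rule LinearCombinations.submodule.intro)
    show "module class_ring (F2_space r)" by (rule vec_module)
    fix c :: bit and v assume "v \<in> {0\<^sub>v r, a, b, a + b}"
    then show "c \<odot>\<^bsub>F2_space r\<^esub> v \<in> {0\<^sub>v r, a, b, a + b}"
      using assms by (cases "c = 0") (auto simp: module_vec_simps)
  qed (use assms s in \<open>auto simp: module_vec_simps\<close>)
qed

text \<open>The witness is the span of \<open>a\<close> and \<open>b\<close>; it lies in the
  four-element set because that set is a submodule containing both. An inclusion is the form wanted
  later, where translates of \<open>L\<close> must land in \<open>C\<close>.\<close>

lemma F2_subspace_plane: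
  fixes a b :: "bit vec"
  assumes ab: "a \<in> carrier_vec r" "b \<in> carrier_vec r"
    and ne: "a \<noteq> 0\<^sub>v r" "b \<noteq> 0\<^sub>v r" "a \<noteq> b"
  shows "\<exists>L \<subseteq> {0\<^sub>v r, a, b, a + b}. F2_subspace_of_dim r 2 L"
proof -
  interpret V: vec_space "TYPE(bit)" r .
  have Bc: "{a, b} \<subseteq> carrier_vec r" using ab by auto
  have [simp]: "dim_vec a = r" "dim_vec b = r" using ab by auto
  have li: "\<not> V.lin_dep {a, b}"
  proof
    assume "V.lin_dep {a, b}"
    then obtain c v where c: "V.lincomb c {a, b} = 0\<^sub>v r" "v \<in> {a, b}" "c v \<noteq> 0"
      using V.finite_lin_dep[of "{a, b}"] Bc by auto
    have "V.lincomb c {a, b} = c a \<cdot>\<^sub>v a + c b \<cdot>\<^sub>v b"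
      using ab ne(3) by (subst V.lincomb_insert2) (auto simp: V.lincomb_insert2)
    with c(1) have "c a \<cdot>\<^sub>v a + c b \<cdot>\<^sub>v b = 0\<^sub>v r" by simp
    moreover have "0 \<cdot>\<^sub>v a = 0\<^sub>v r" "0 \<cdot>\<^sub>v b = 0\<^sub>v r"
      by (auto intro!: eq_vecI)
    \<comment> \<open>Coefficients are 0 or 1, so a nontrivial relation reads \<open>a = 0\<close>,
      \<open>b = 0\<close> or \<open>a + b = 0\<close>, and the last means
      \<open>a = b\<close>.\<close>
    ultimately have "c a = 0 \<and> c b = 0"
      using ne ab bit_vec_add_eq_0_iff[OF ab]
      by (cases "c a = 0"; cases "c b = 0") simp_all
    with c(2,3) show False by auto
  qed
  have sub: "VectorSpace.subspace class_ring (V.span {a, b}) (F2_space r)"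
    by (rule V.span_is_subspace[OF Bc])
  interpret W: vectorspace class_ring "F2_space r\<lparr>carrier := V.span {a, b}\<rparr>"
    by (rule V.subspace_is_vs[OF sub])
  have sm: "submodule class_ring (V.span {a, b}) (F2_space r)"
    using sub by (simp add: VectorSpace.subspace_def)
  have inB: "{a, b} \<subseteq> V.span {a, b}"
    by (rule V.in_own_span[OF Bc])
  \<comment> \<open>Span and independence have the same meaning in the subspace as in the ambient
    space, so both transfer.\<close>
  have "W.basis {a, b}"
    unfolding W.basis_def using li inB
    by (simp only: V.span_li_not_depend[OF inB sm] V.carrier_vs_is_self simp_thms)
  then have "W.dim = 2"
    using ne by (subst W.dim_basis) auto
  moreover have "V.span {a, b} \<subseteq> {0\<^sub>v r, a, b, a + b}"
    by (rule V.span_is_subset[OF _ submodule_plane[OF ab]]) auto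
  ultimately show ?thesis
    using sub unfolding F2_subspace_of_dim_def by blast
qed

text \<open>The two vectors form a basis of \<open>L\<close>: they are nonzero because an
  independent set omits 0, and \<open>a + b\<close> stays in \<open>L\<close> by closure.\<close>

lemma F2_subspace_plane_obtain:
  assumes "F2_subspace_of_dim r 2 L"
  obtains a b where "a \<in> carrier_vec r" "b \<in> carrier_vec r"
    "a \<noteq> 0\<^sub>v r" "b \<noteq> 0\<^sub>v r" "a \<noteq> b" "{a, b, a + b} \<subseteq> L"
proof -
  interpret V: vec_space "TYPE(bit)" r .
  have sub: "VectorSpace.subspace class_ring L (F2_space r)"
    and dim: "vectorspace.dim class_ring (F2_space r\<lparr>carrier := L\<rparr>) = 2"
    using assms by (auto simp: F2_subspace_of_dim_def)
  interpret W: vectorspace class_ring "F2_space r\<lparr>carrier := L\<rparr>"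
    by (rule V.subspace_is_vs[OF sub])
  have sm: "submodule class_ring L (F2_space r)"
    using sub by (simp add: VectorSpace.subspace_def)
  have Lc: "L \<subseteq> carrier_vec r"
    using submodule.subset[OF sm] by (simp only: module_vec_simps)
  \<comment> \<open>A basis can be extracted once \<open>L\<close> is finite-dimensional, and it is,
    being a finite spanning set of itself.\<close>
  have "finite L" using Lc finite_carrier_vec_bit finite_subset by blast
  moreover have "W.span L = L"
    using W.in_own_span[of L] W.span_is_subset2[of L] by auto
  ultimately have "W.fin_dim"
    unfolding W.fin_dim_def by (intro exI[of _ L]) simp
  then obtain B where B: "finite B" "W.basis B"
    using W.finite_basis_exists by blast
  then have "card B = 2" using W.dim_basis dim by metis
  then obtain a b where Bab: "B = {a, b}" "a \<noteq> b" by (meson card_2_iff)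
  have BL: "B \<subseteq> L" and li: "\<not> W.lin_dep B" using B unfolding W.basis_def by auto
  have z: "0\<^sub>v r \<notin> B"
    using W.vs_zero_lin_dep[OF _ li] BL by (simp add: module_vec_simps)
  have "a + b \<in> L"
    using submodule.m_closed[OF sm, of a b] BL Bab by (simp add: module_vec_simps)
  then show thesis using that[of a b] Bab BL z Lc by auto
qed

section \<open>Translated planes and sums of three distinct vectors\<close>

lemma translated_plane_iff:
  fixes v :: "bit vec"
  assumes C: "C \<subseteq> carrier_vec r" and v: "v \<in> carrier_vec r"
  shows "(\<exists>L. F2_subspace_of_dim r 2 L \<and> (\<lambda>u. v + u) ` (L - {0\<^sub>v r}) \<subseteq> C) \<longleftrightarrow>
      (\<exists>x \<in> C. \<exists>y \<in> C. \<exists>z \<in> C. x \<noteq> y \<and> x \<noteq> z \<and> y \<noteq> z \<and> v = x + y + z)"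
    (is "?L \<longleftrightarrow> ?R")
proof
  assume ?L
  then obtain L where L: "F2_subspace_of_dim r 2 L" "(\<lambda>u. v + u) ` (L - {0\<^sub>v r}) \<subseteq> C"
    by blast
  obtain a b where ab: "a \<in> carrier_vec r" "b \<in> carrier_vec r"
    "a \<noteq> 0\<^sub>v r" "b \<noteq> 0\<^sub>v r" "a \<noteq> b" "{a, b, a + b} \<subseteq> L"
    using F2_subspace_plane_obtain[OF L(1)] .
  have [simp]: "dim_vec a = r" "dim_vec b = r" "dim_vec v = r" using ab v by auto
  have "a + b \<noteq> 0\<^sub>v r"
    using bit_vec_add_eq_0_iff ab by blast
  moreover have "a + b \<noteq> a"
    using bit_vec_add_left_cancel[of a r b "0\<^sub>v r"] ab by auto
  moreover have "a + b \<noteq> b"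
    using bit_vec_add_left_cancel[of b r a "0\<^sub>v r"] ab comm_add_vec[of a r b] by auto
  ultimately have n: "a + b \<noteq> 0\<^sub>v r" "a + b \<noteq> a" "a + b \<noteq> b" .
  have "v = (v + a) + (v + b) + (v + (a + b))"
    by (auto intro!: eq_vecI simp: ac_simps)
  moreover have "v + a \<in> C" "v + b \<in> C" "v + (a + b) \<in> C"
    using L(2) ab n by auto
  moreover have "v + a \<noteq> v + b" "v + a \<noteq> v + (a + b)" "v + b \<noteq> v + (a + b)"
    using bit_vec_add_left_cancel[OF v] ab n by (metis add_carrier_vec)+
  ultimately show ?R by blast
next
  assume ?R
  then obtain x y z where xyz: "x \<in> C" "y \<in> C" "z \<in> C" "x \<noteq> y" "x \<noteq> z" "y \<noteq> z"
    and veq: "v = x + y + z" by blast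
  have c: "x \<in> carrier_vec r" "y \<in> carrier_vec r" "z \<in> carrier_vec r" using xyz C by auto
  then have [simp]: "dim_vec x = r" "dim_vec y = r" "dim_vec z = r" by auto
  \<comment> \<open>The plane is spanned by \<open>v + x = y + z\<close> and
    \<open>v + y = x + z\<close>. They are nonzero since \<open>y\<close> and \<open>x\<close>
    differ from \<open>z\<close>, and distinct since \<open>x\<close> and \<open>y\<close>
    differ.\<close>
  have "y + z \<noteq> x + z"
    using bit_vec_add_left_cancel[of z r y x] c xyz(4)
      comm_add_vec[of y r z] comm_add_vec[of x r z] by auto
  then obtain L where L: "L \<subseteq> {0\<^sub>v r, y + z, x + z, y + z + (x + z)}"
    "F2_subspace_of_dim r 2 L"
    using F2_subspace_plane[of "y + z" r "x + z"] bit_vec_add_eq_0_iff c xyz by auto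
  have "v + (y + z) = x" "v + (x + z) = y" "v + (y + z + (x + z)) = z"
    unfolding veq by (auto intro!: eq_vecI simp: ac_simps)
  then have "(\<lambda>u. v + u) ` (L - {0\<^sub>v r}) \<subseteq> C"
    using L(1) xyz(1-3) by auto
  with L(2) show ?L by blast
qed

lemma d_complete_2_iff: "d_complete r 2 C \<longleftrightarrow> three_sum_representing r C"
  unfolding d_complete_def three_sum_representing_def
  using translated_plane_iff[of C r] by (metis (lifting))

section \<open>Lower and upper bounds for the size of a representing set\<close>

lemma three_sum_representing_card:
  assumes "three_sum_representing r C"
  shows "2 ^ r \<le> card C ^ 3"
proof -
  have C: "C \<subseteq> carrier_vec r" using assms by (simp add: three_sum_representing_def)
  then have fin: "finite C" using finite_carrier_vec_bit finite_subset by blast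
  have "carrier_vec r \<subseteq> (\<lambda>(x, y, z). x + y + z) ` (C \<times> C \<times> C)"
  proof
    fix v :: "bit vec" assume "v \<in> carrier_vec r"
    then obtain x y z where "x \<in> C" "y \<in> C" "z \<in> C" "v = x + y + z"
      using assms unfolding three_sum_representing_def by blast
    then show "v \<in> (\<lambda>(x, y, z). x + y + z) ` (C \<times> C \<times> C)"
      by (intro image_eqI[of _ _ "(x, y, z)"]) auto
  qed
  then have "card (carrier_vec r :: bit vec set) \<le> card (C \<times> C \<times> C)"
    using fin by (intro surj_card_le) auto
  then show ?thesis
    by (simp add: card_carrier_vec_bit card_cartesian_product power3_eq_cube)
qed

lemma three_sum_representing_exists:
  assumes "r \<ge> 2"
  shows "\<exists>C. three_sum_representing r C \<and> card C \<le> 24 * 2 ^ (r div 3)"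
proof -
  define k where "k = r div 3"
  define A where "A I = indicator_vec r ` Pow I" for I
  define I1 I2 I3 where I: "I1 = {..<k}" "I2 = {k..<2 * k}" "I3 = {2 * k..<r}"
  \<comment> \<open>The last block absorbs the remainder of \<open>r\<close> modulo 3, at most 2
    extra coordinates.\<close>
  have kr: "2 * k \<le> r" "r - 2 * k \<le> k + 2" unfolding k_def by linarith+
  define U where "U = A I1 \<union> A I2 \<union> A I3"
  obtain a b :: "bit vec" where ab: "a \<in> carrier_vec r" "b \<in> carrier_vec r"
      "a \<noteq> 0\<^sub>v r" "b \<noteq> 0\<^sub>v r" "a \<noteq> b"
    \<comment> \<open>Any plane will do; \<open>r \<ge> 2\<close> guarantees that there is
      one.\<close>
    using F2_subspace_of_dim_exists[OF assms] F2_subspace_plane_obtain by metis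
  then have [simp]: "dim_vec a = r" "dim_vec b = r" by auto
  define P where "P = {0\<^sub>v r, a, b, a + b}"
  define C where "C = (\<lambda>(v, p). v + p) ` (U \<times> P)"
  have Uc: "U \<subseteq> carrier_vec r" by (auto simp: U_def A_def)
  have Pc: "P \<subseteq> carrier_vec r" using ab by (auto simp: P_def)
  have Cc: "C \<subseteq> carrier_vec r" using Uc Pc by (fastforce simp: C_def)
  have UC: "U \<subseteq> C"
  proof
    fix v assume "v \<in> U"
    then have "v + 0\<^sub>v r = v" using Uc by auto
    with \<open>v \<in> U\<close> show "v \<in> C"
      unfolding C_def P_def by (intro image_eqI[of _ _ "(v, 0\<^sub>v r)"]) auto
  qed
  have "three_sum_representing r C"
    unfolding three_sum_representing_def
  proof (intro conjI ballI Cc)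
    fix v :: "bit vec" assume v: "v \<in> carrier_vec r"
    then obtain S where S: "S \<subseteq> {..<r}" "v = indicator_vec r S"
      by (auto simp: carrier_vec_indicator)
    show "\<exists>x \<in> C. \<exists>y \<in> C. \<exists>z \<in> C. x \<noteq> y \<and> x \<noteq> z \<and> y \<noteq> z \<and> v = x + y + z"
    proof (cases "v \<in> U")
      case True
      \<comment> \<open>Here \<open>C\<close> contains all of \<open>v + P\<close>, hence a
        translated plane at \<open>v\<close>, which yields the three distinct summands.\<close>
      obtain L where L: "L \<subseteq> P" "F2_subspace_of_dim r 2 L"
        using F2_subspace_plane[OF ab] unfolding P_def by blast
      have "(\<lambda>u. v + u) ` (L - {0\<^sub>v r}) \<subseteq> C"
        using True L(1) unfolding C_def by auto
      with L(2) show ?thesis using translated_plane_iff[OF Cc v] by blast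
    next
      case False
      define x y z where xyz: "x = indicator_vec r (S \<inter> I1)"
        "y = indicator_vec r (S \<inter> I2)" "z = indicator_vec r (S \<inter> I3)"
      have "x \<in> U" "y \<in> U" "z \<in> U" by (auto simp: U_def A_def xyz)
      moreover have "v = x + y + z"
        using S kr by (auto intro!: eq_vecI simp: xyz indicator_vec_def I)
      \<comment> \<open>If two summands agreed, \<open>v\<close> would equal the third and so lie in
        \<open>U\<close>, contrary to this case.\<close>
      moreover have "x + x + z = z" "x + y + x = y" "x + y + y = x"
        by (auto intro!: eq_vecI simp: xyz indicator_vec_def)
      ultimately show ?thesis using False UC by (metis subsetD)
    qed
  qed
  \<comment> \<open>The constant is \<open>24 = 6 * 4\<close>: the blocks contribute at most
    \<open>(1 + 1 + 4) * 2 ^ k\<close> vectors to \<open>U\<close>, and \<open>P\<close> has at most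
    4 elements.\<close>
  moreover have "card C \<le> 24 * 2 ^ k"
  proof -
    have fin: "finite (A J)" and cA: "card (A J) \<le> 2 ^ card J" if "finite J" for J
      unfolding A_def using that card_image_le[of "Pow J" "indicator_vec r"]
      by (auto simp: card_Pow)
    have "card U \<le> card (A I1) + card (A I2) + card (A I3)"
      unfolding U_def by (meson card_Un_le add_right_mono order_trans)
    also have "\<dots> \<le> 2 ^ k + 2 ^ k + 2 ^ (k + 2)"
    proof (intro add_mono)
      show "card (A I3) \<le> 2 ^ (k + 2)"
        using cA[of I3] kr(2) power_increasing[of "r - 2 * k" "k + 2" "2 :: nat"]
        by (simp add: I del: power_add)
    qed (use cA[of I1] cA[of I2] in \<open>auto simp: I\<close>)
    finally have "card U \<le> 6 * 2 ^ k" by simp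
    moreover have "card P \<le> 4"
      unfolding P_def using card_length[of "[0\<^sub>v r, a, b, a + b]"] by simp
    moreover have "card C \<le> card U * card P"
      unfolding C_def card_cartesian_product[symmetric]
      by (rule card_image_le) (simp add: U_def P_def fin I)
    ultimately show ?thesis
      using mult_mono[of "card U" "6 * 2 ^ k" "card P" 4] by simp
  qed
  ultimately show ?thesis unfolding k_def by blast
qed

section \<open>The minimum \<open>gamma r 2\<close> and its order of growth\<close>

theorem theorem2:
  shows "(\<forall>r\<ge>2.
            (\<exists>C. three_sum_representing r C \<and> card C = gamma r 2) \<and>
            (\<forall>C. three_sum_representing r C \<longrightarrow> gamma r 2 \<le> card C)) \<and>
         (\<exists>c1 c2 :: real. 0 < c1 \<and> c1 \<le> c2 \<and>
            (\<forall>r\<ge>2. c1 * 2 powr (real r / 3) \<le> real (gamma r 2) \<and>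
                    real (gamma r 2) \<le> c2 * 2 powr (real r / 3)))"
proof -
  \<comment> \<open>\<open>LEAST\<close> is attained because the whole space is 2-complete when
    \<open>r \<ge> 2\<close>.\<close>
  have attained: "\<exists>C. three_sum_representing r C \<and> card C = gamma r 2" if "r \<ge> 2" for r
    using LeastI_ex[of "\<lambda>n. \<exists>C. d_complete r 2 C \<and> card C = n"]
      d_complete_carrier_vec[OF that]
    unfolding gamma_def d_complete_2_iff by blast
  have minimal: "gamma r 2 \<le> card C" if "three_sum_representing r C" for r C
    unfolding gamma_def d_complete_2_iff using that by (intro Least_le) blast
  have lower: "2 powr (real r / 3) \<le> real (gamma r 2)" if r: "r \<ge> 2" for r
  proof -
    have "2 ^ r \<le> gamma r 2 ^ 3"
      using attained[OF r] three_sum_representing_card by metis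
    then have "(2 :: real) ^ r \<le> real (gamma r 2) ^ 3"
      by (metis of_nat_le_iff of_nat_numeral of_nat_power)
    \<comment> \<open>Both sides of the bound are nonnegative, so they may be compared through their
      cubes.\<close>
    moreover have "(2 powr (real r / 3)) ^ 3 = (2 :: real) ^ r"
      by (simp add: powr_powr powr_realpow flip: powr_numeral)
    ultimately show ?thesis
      by (metis of_nat_0_le_iff power_mono_iff powr_ge_zero zero_less_numeral)
  qed
  have upper: "real (gamma r 2) \<le> 24 * 2 powr (real r / 3)" if r: "r \<ge> 2" for r
  proof -
    have "gamma r 2 \<le> 24 * 2 ^ (r div 3)"
      using three_sum_representing_exists[OF r] minimal order_trans by blast
    then have "real (gamma r 2) \<le> real (24 * 2 ^ (r div 3))"
      by (rule of_nat_mono)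
    also have "\<dots> = 24 * 2 ^ (r div 3)" by simp
    also have "(2 :: real) ^ (r div 3) = 2 powr real (r div 3)"
      by (simp add: powr_realpow)
    \<comment> \<open>Integer division rounds down, so the exponent only grows; the remainder was
      already paid for in the constant 24.\<close>
    also have "\<dots> \<le> 2 powr (real r / 3)"
    proof (rule powr_mono)
      have "3 * (r div 3) \<le> r" by simp
      then show "real (r div 3) \<le> real r / 3" by linarith
    qed simp
    finally show ?thesis by simp
  qed
  show ?thesis
    using attained minimal lower upper
    by (intro conjI exI[of _ 1] exI[of _ 24]) auto
qed

end
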